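(* Let $G$ be a bipartite graph with nonempty bipartition $(A,B)$. Then $$\partial(G) + \partial(\bar{G}) = 2(2^{|A|} - 1)(2^{|B|} - 1) + 2$$ if and only if at least one of the following is satisfied: (i) $\min\{|A|,|B|\} = 1$; (ii) $|A| = |B| = 2$ and $G \cong 2K_2$; (iii) $G \cong K_{|A|,|B|}$.
   Context: Graphs are finite and simple (undirected, no loops or multiple edges), and $\bar{G}$ denotes the complement of $G$ (on the same vertex set). A subset $S \subseteq V(G)$ is dominating in $G$ if every vertex of $G$ is either in $S$ or adjacent in $G$ to a vertex of $S$. $\partial(G)$ denotes the number of dominating sets of $G$. A graph $G$ is bipartite with nonempty bipartition $(A,B)$ if $V(G)$ is the disjoint union of the nonempty sets $A$ and $B$ and $G$ has no edge with both endpoints in $A$ and no edge with both endpoints in $B$. $2K_2$ is the disjoint union of two copies of the single-edge graph $K_2$, and $K_{m,n}$ is the complete bipartite graph with parts of sizes $m$ and $n$. *)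

theory Defs
  imports "Graph_Theory.Graph_Theory"
begin

text \<open>
  A finite simple graph is a \<^typ>\<open>'a pair_pre_digraph\<close> satisfying \<^locale>\<open>pair_graph\<close>: finite,
  loop-free, and with a symmetric arc relation, so an undirected edge is a pair of opposite arcs.
\<close>

definition graph_complement :: "'a pair_pre_digraph \<Rightarrow> 'a pair_pre_digraph" where
  "graph_complement G =
     \<lparr> pverts = pverts G,
       parcs = {(u, v). u \<in> pverts G \<and> v \<in> pverts G \<and> u \<noteq> v \<and> (u, v) \<notin> parcs G} \<rparr>"

definition dominating :: "'a pair_pre_digraph \<Rightarrow> 'a set \<Rightarrow> bool" where
  "dominating G S \<longleftrightarrow>
     S \<subseteq> pverts G \<and> (\<forall>v\<in>pverts G. v \<in> S \<or> (\<exists>u\<in>S. (v, u) \<in> parcs G))"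

definition num_dominating :: "'a pair_pre_digraph \<Rightarrow> nat" where
  "num_dominating G = card {S. dominating G S}"

definition nonempty_bipartition :: "'a pair_pre_digraph \<Rightarrow> 'a set \<Rightarrow> 'a set \<Rightarrow> bool" where
  "nonempty_bipartition G A B \<longleftrightarrow>
     pverts G = A \<union> B \<and> A \<inter> B = {} \<and> A \<noteq> {} \<and> B \<noteq> {} \<and>
     (\<forall>u\<in>A. \<forall>v\<in>A. (u, v) \<notin> parcs G) \<and> (\<forall>u\<in>B. \<forall>v\<in>B. (u, v) \<notin> parcs G)"

definition two_K2 :: "nat pair_pre_digraph" where
  "two_K2 = \<lparr> pverts = {0, 1, 2, 3}, parcs = {(0, 1), (1, 0), (2, 3), (3, 2)} \<rparr>"

lemma pair_graph_complement:
  assumes "pair_graph G"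
  shows "pair_graph (graph_complement G)"
proof -
  interpret pair_graph G by fact
  have "parcs (graph_complement G) \<subseteq> pverts G \<times> pverts G"
    by (auto simp: graph_complement_def)
  then have "finite (parcs (graph_complement G))"
    by (rule finite_subset) (simp add: pair_finite_verts)
  moreover have "(v, u) \<in> parcs G" if "(u, v) \<in> parcs G" for u v
    using that pair_sym_arcs by (auto simp: symmetric_def elim: symE)
  ultimately show ?thesis
    by unfold_locales
      (auto simp: graph_complement_def pair_finite_verts symmetric_def intro!: symI)
qed

lemma pair_graph_two_K2: "pair_graph two_K2"
  by unfold_locales (auto simp: two_K2_def symmetric_def intro!: symI)

end

theory Submission
  imports Defs
begin

text \<open>
  Write \<open>a = |A|\<close>, \<open>b = |B|\<close> and split a vertex set as \<open>X \<union> Y\<close> with \<open>X \<subseteq> A\<close>, \<open>Y \<subseteq> B\<close>.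

  In the complement both parts are cliques, so all \<open>(2^a - 1) (2^b - 1)\<close> sets meeting both parts
  dominate, and a set inside \<open>A\<close> dominates exactly when no vertex of \<open>B\<close> is adjacent in \<open>G\<close> to all of
  it. In \<open>G\<close> the sets meeting both parts dominate except for the "bad" ones, and a set inside one
  part dominates exactly when it is the whole part and the other part has no isolated vertex. If \<open>p\<close>
  and \<open>q\<close> are the numbers of one-sided dominating sets of the complement, the equation therefore says
  \<open>p + q + [no isolated vertex in A] + [no isolated vertex in B] = bad + 2\<close>, which is the predicate
  \<open>balanced\<close> below. It is a statement about a relation between two finite sets.

  For \<open>a, b \<ge> 2\<close> bad pairs are produced as follows. Pass to the relative complement of a set counted
  by \<open>p\<close>: this is a set \<open>X\<close> such that every \<open>w \<in> B\<close> has a non-neighbour in \<open>A - X\<close>, so \<open>(X, {w})\<close> is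
  bad for every \<open>w\<close>; symmetrically for \<open>q\<close>. These families overlap only in pairs of singletons, and
  almost all pairs of singletons are bad: unless both parts contain a vertex adjacent to the whole
  other part, the dominating ("tight") ones form a matching, and a vertex in a tight pair does not
  arise as a singleton \<open>X\<close>. Counting the pairs of singletons separately gives the lemma \<open>slack_inequality\<close>,
  \<open>p + q + a b + tight + extra \<le> bad + a + b + [no full vertex in A] + [no full vertex in B]\<close>,
  where \<open>extra\<close> counts the bad pairs of none of the kinds mentioned.

  It remains to find enough tight or extra pairs. A vertex \<open>v\<close> with non-neighbours \<open>C\<close> is left
  undominated by \<open>(A - {v}, C)\<close>, and this pair is extra unless it is a pair of singletons, which
  forces \<open>a = 2\<close> and, if the vertex in \<open>C\<close> is not isolated, makes \<open>v\<close> part of a tight pair. So if \<open>A\<close>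
  has no full and \<open>B\<close> no isolated vertex, there are at least \<open>a\<close> tight or extra pairs, and
  \<open>(a - 1) b \<ge> 2\<close> with equality only for \<open>a = b = 2\<close> excludes equality outside \<open>2K\<^sub>2\<close>; the
  same holds with the parts exchanged. If neither applies, an isolated vertex yields an extra pair,
  which is enough. If both parts contain full vertices, then \<open>p = q = 0\<close>, and a single missing edge already makes a pair
  bad. The equality cases are checked by direct counting.
\<close>

section \<open>Counts attached to a bipartite relation\<close>

definition undominated :: "'a set \<Rightarrow> 'b set \<Rightarrow> ('a \<Rightarrow> 'b \<Rightarrow> bool) \<Rightarrow> 'a set \<Rightarrow> 'b set \<Rightarrow> bool" where
  "undominated A B E X Y \<longleftrightarrow>
     (\<exists>v\<in>A - X. \<forall>w\<in>Y. \<not> E v w) \<or> (\<exists>w\<in>B - Y. \<forall>v\<in>X. \<not> E v w)"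

definition bad_pairs :: "'a set \<Rightarrow> 'b set \<Rightarrow> ('a \<Rightarrow> 'b \<Rightarrow> bool) \<Rightarrow> ('a set \<times> 'b set) set" where
  "bad_pairs A B E =
     {(X, Y). X \<subseteq> A \<and> Y \<subseteq> B \<and> X \<noteq> {} \<and> Y \<noteq> {} \<and> undominated A B E X Y}"

text \<open>
  Relative complements of the subsets of \<open>A\<close> that lie in no neighbourhood of a vertex of \<open>B\<close>.
  The complemented form is chosen because a nonempty member \<open>X\<close> is directly the first component of the
  bad pairs \<open>(X, {w})\<close>.
\<close>

definition spread :: "'a set \<Rightarrow> 'b set \<Rightarrow> ('a \<Rightarrow> 'b \<Rightarrow> bool) \<Rightarrow> 'a set set" where
  "spread A B E = {X. X \<subseteq> A \<and> (\<forall>w\<in>B. \<exists>v\<in>A - X. \<not> E v w)}"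

definition tight_pairs :: "'a set \<Rightarrow> 'b set \<Rightarrow> ('a \<Rightarrow> 'b \<Rightarrow> bool) \<Rightarrow> ('a \<times> 'b) set" where
  "tight_pairs A B E = {(v, w). v \<in> A \<and> w \<in> B \<and> \<not> undominated A B E {v} {w}}"

text \<open>
  The bad pairs that remain after the pairs of singletons and the pairs obtained from members of
  the two \<open>spread\<close> families are set aside.
\<close>

definition extra_pairs :: "'a set \<Rightarrow> 'b set \<Rightarrow> ('a \<Rightarrow> 'b \<Rightarrow> bool) \<Rightarrow> ('a set \<times> 'b set) set" where
  "extra_pairs A B E =
     {(X, Y) \<in> bad_pairs A B E.
        \<not> (is_singleton X \<and> is_singleton Y) \<and>
        \<not> (is_singleton X \<and> Y \<in> spread B A E\<inverse>\<inverse>) \<and>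
        \<not> (is_singleton Y \<and> X \<in> spread A B E)}"

definition none_isolated :: "'a set \<Rightarrow> 'b set \<Rightarrow> ('a \<Rightarrow> 'b \<Rightarrow> bool) \<Rightarrow> bool" where
  "none_isolated A B E \<longleftrightarrow> (\<forall>v\<in>A. \<exists>w\<in>B. E v w)"

definition none_full :: "'a set \<Rightarrow> 'b set \<Rightarrow> ('a \<Rightarrow> 'b \<Rightarrow> bool) \<Rightarrow> bool" where
  "none_full A B E \<longleftrightarrow> (\<forall>v\<in>A. \<exists>w\<in>B. \<not> E v w)"

text \<open>
  The form that the equation for the two numbers of dominating sets takes once the common main
  term \<open>2 (2^|A| - 1) (2^|B| - 1)\<close> has been cancelled.
\<close>

definition balanced :: "'a set \<Rightarrow> 'b set \<Rightarrow> ('a \<Rightarrow> 'b \<Rightarrow> bool) \<Rightarrow> bool" where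
  "balanced A B E \<longleftrightarrow>
     card (spread A B E) + card (spread B A E\<inverse>\<inverse>)
       + of_bool (none_isolated A B E) + of_bool (none_isolated B A E\<inverse>\<inverse>)
     = card (bad_pairs A B E) + 2"

text \<open>
  Exchanging the two sides replaces \<open>E\<close> by its converse; every count below is used in both orientations.
\<close>

lemma undominated_conversep: "undominated B A E\<inverse>\<inverse> Y X \<longleftrightarrow> undominated A B E X Y"
  unfolding undominated_def by auto

lemma bad_pairs_conversep: "bad_pairs B A E\<inverse>\<inverse> = prod.swap ` bad_pairs A B E"
  by (force simp: bad_pairs_def undominated_conversep image_iff)

lemma tight_pairs_conversep: "tight_pairs B A E\<inverse>\<inverse> = prod.swap ` tight_pairs A B E"
  by (force simp: tight_pairs_def undominated_conversep image_iff)

lemma extra_pairs_conversep: "extra_pairs B A E\<inverse>\<inverse> = prod.swap ` extra_pairs A B E"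
  by (force simp: extra_pairs_def bad_pairs_conversep image_iff)

lemma card_swap: "card (prod.swap ` S) = card S"
  by (rule card_image) (rule inj_on_inverseI[of _ prod.swap], simp)

lemma balanced_conversep: "balanced B A E\<inverse>\<inverse> \<longleftrightarrow> balanced A B E"
  by (auto simp: balanced_def bad_pairs_conversep card_swap)

lemma finite_bad_pairs: "finite A \<Longrightarrow> finite B \<Longrightarrow> finite (bad_pairs A B E)"
  by (rule finite_subset[of _ "Pow A \<times> Pow B"]) (auto simp: bad_pairs_def)

lemma finite_extra_pairs: "finite A \<Longrightarrow> finite B \<Longrightarrow> finite (extra_pairs A B E)"
  by (rule finite_subset[OF _ finite_bad_pairs]) (auto simp: extra_pairs_def)

lemma finite_tight_pairs: "finite A \<Longrightarrow> finite B \<Longrightarrow> finite (tight_pairs A B E)"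
  by (rule finite_subset[of _ "A \<times> B"]) (auto simp: tight_pairs_def)

lemma finite_spread: "finite A \<Longrightarrow> finite (spread A B E)"
  by (rule finite_subset[of _ "Pow A"]) (auto simp: spread_def)

section \<open>The slack inequality\<close>

lemma tight_pairs_iff:
  "(v, w) \<in> tight_pairs A B E \<longleftrightarrow>
     v \<in> A \<and> w \<in> B \<and> (\<forall>v'\<in>A - {v}. E v' w) \<and> (\<forall>w'\<in>B - {w}. E v w')"
  by (auto simp: tight_pairs_def undominated_def)

text \<open>
  If \<open>v\<close> formed tight pairs with two vertices \<open>w\<close> and \<open>w'\<close>, each pair would supply the edge that the
  other leaves open, so both \<open>v\<close> and \<open>w\<close> would be adjacent to the whole opposite side.
\<close>

lemma inj_on_fst_tight_pairs:
  assumes "none_full A B E \<or> none_full B A E\<inverse>\<inverse>"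
  shows "inj_on fst (tight_pairs A B E)"
proof (rule inj_onI, clarsimp)
  fix v w w' assume t: "(v, w) \<in> tight_pairs A B E" "(v, w') \<in> tight_pairs A B E"
  show "w = w'"
  proof (rule ccontr)
    assume "w \<noteq> w'"
    then have "\<forall>x\<in>B. E v x" "\<forall>x\<in>A. E x w" "v \<in> A" "w \<in> B"
      using t unfolding tight_pairs_iff by blast+
    then show False using assms by (auto simp: none_full_def)
  qed
qed

text \<open>
  The empty set belongs to \<open>spread\<close> exactly when \<open>B\<close> has no full vertex. The singletons in it avoid
  the tight pairs: if \<open>(v, w)\<close> is tight, then \<open>w\<close> has no non-neighbour other than \<open>v\<close>. So at most
  \<open>|A| - tight\<close> singletons occur.
\<close>

lemma card_spread_le:
  assumes fin: "finite A"
    and nf: "none_full A B E \<or> none_full B A E\<inverse>\<inverse>"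
  shows "card (spread A B E) + card (tight_pairs A B E)
    \<le> of_bool (none_full B A E\<inverse>\<inverse>) + card A + card {X \<in> spread A B E. 2 \<le> card X}"
proof -
  define P0 where "P0 = {X \<in> spread A B E. X = {}}"
  define P1 where "P1 = {v \<in> A. {v} \<in> spread A B E}"
  define P2 where "P2 = {X \<in> spread A B E. 2 \<le> card X}"
  have f: "finite (spread A B E)" "finite P0" "finite P1" "finite P2"
    using fin finite_spread[OF fin, of B E] by (simp_all add: P0_def P1_def P2_def)
  have "spread A B E \<subseteq> P0 \<union> (\<lambda>v. {v}) ` P1 \<union> P2"
  proof
    fix X assume X: "X \<in> spread A B E"
    then have "finite X" using fin by (auto simp: spread_def intro: finite_subset)
    then consider "X = {}" | "card X = 1" | "2 \<le> card X"
      by (metis One_nat_def Suc_leI card_gt_0_iff le_neq_implies_less one_add_one plus_1_eq_Suc)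
    then show "X \<in> P0 \<union> (\<lambda>v. {v}) ` P1 \<union> P2"
    proof cases
      case 2
      then obtain v where "X = {v}" by (auto simp: card_1_singleton_iff)
      then show ?thesis using X by (auto simp: P1_def spread_def)
    qed (use X in \<open>auto simp: P0_def P2_def\<close>)
  qed
  then have "card (spread A B E) \<le> card (P0 \<union> (\<lambda>v. {v}) ` P1 \<union> P2)"
    using f by (intro card_mono) auto
  also have "\<dots> \<le> card P0 + card P1 + card P2"
    by (meson add_mono card_Un_le card_image_le f(3) le_refl order_trans)
  finally have s: "card (spread A B E) \<le> card P0 + card P1 + card P2" .
  have P0: "card P0 \<le> of_bool (none_full B A E\<inverse>\<inverse>)"
  proof -
    have "P0 = (if none_full B A E\<inverse>\<inverse> then {{}} else {})"
      by (auto simp: P0_def spread_def none_full_def)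
    then show ?thesis by simp
  qed
  have "P1 \<inter> fst ` tight_pairs A B E = {}"
    by (auto simp: P1_def spread_def tight_pairs_iff) blast
  moreover have "P1 \<union> fst ` tight_pairs A B E \<subseteq> A"
    by (auto simp: P1_def tight_pairs_iff)
  ultimately have "card P1 + card (fst ` tight_pairs A B E) \<le> card A"
    by (metis card_Un_disjoint card_mono f(3) fin finite_Un finite_subset)
  then have "card P1 + card (tight_pairs A B E) \<le> card A"
    by (simp add: card_image[OF inj_on_fst_tight_pairs[OF nf]])
  then show ?thesis using s P0 unfolding P2_def by linarith
qed

text \<open>
  Four disjoint families of bad pairs: pairs of singletons that are not tight, larger members of each \<open>spread\<close>
  family combined with one fixed vertex of the other side, and the extra pairs.
\<close>

lemma card_bad_pairs_ge:
  assumes fin: "finite A" "finite B" and ne: "A \<noteq> {}" "B \<noteq> {}"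
  shows "card A * card B + card {X \<in> spread A B E. 2 \<le> card X}
      + card {Y \<in> spread B A E\<inverse>\<inverse>. 2 \<le> card Y} + card (extra_pairs A B E)
    \<le> card (bad_pairs A B E) + card (tight_pairs A B E)"
proof -
  obtain v0 w0 where v0: "v0 \<in> A" and w0: "w0 \<in> B" using ne by blast
  define P where "P = {X \<in> spread A B E. 2 \<le> card X}"
  define Q where "Q = {Y \<in> spread B A E\<inverse>\<inverse>. 2 \<le> card Y}"
  define S where "S = (\<lambda>(v, w). ({v}, {w})) ` (A \<times> B - tight_pairs A B E)"
  define SP where "SP = (\<lambda>X. (X, {w0})) ` P"
  define SQ where "SQ = (\<lambda>Y. ({v0}, Y)) ` Q"
  have f: "finite S" "finite SP" "finite SQ"
    using fin finite_spread[OF fin(1), of B E] finite_spread[OF fin(2), of A "E\<inverse>\<inverse>"]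
    by (auto simp: S_def SP_def SQ_def P_def Q_def)
  have cSP: "card SP = card P" unfolding SP_def by (rule card_image) (auto intro: inj_onI)
  have cSQ: "card SQ = card Q" unfolding SQ_def by (rule card_image) (auto intro: inj_onI)
  have "card S = card (A \<times> B - tight_pairs A B E)"
    unfolding S_def by (rule card_image) (auto intro!: inj_onI)
  also have "\<dots> = card A * card B - card (tight_pairs A B E)"
    using fin finite_tight_pairs[OF fin]
    by (subst card_Diff_subset) (auto simp: tight_pairs_def card_cartesian_product)
  finally have cS: "card A * card B \<le> card S + card (tight_pairs A B E)" by simp
  have big: "X \<noteq> {}" "\<And>x. X \<noteq> {x}" if "2 \<le> card X" for X :: "'c set"
    using that by auto
  have sub: "S \<union> SP \<union> SQ \<union> extra_pairs A B E \<subseteq> bad_pairs A B E"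
  proof -
    have "S \<subseteq> bad_pairs A B E"
      by (auto simp: S_def bad_pairs_def tight_pairs_def)
    moreover have "SP \<subseteq> bad_pairs A B E"
      using w0 big by (auto simp: SP_def P_def bad_pairs_def spread_def undominated_def)
    moreover have "SQ \<subseteq> bad_pairs A B E"
      using v0 big by (auto simp: SQ_def Q_def bad_pairs_def spread_def undominated_def)
    ultimately show ?thesis by (auto simp: extra_pairs_def)
  qed
  have d1: "S \<inter> SP = {}" "(S \<union> SP) \<inter> SQ = {}"
    by (auto simp: S_def SP_def SQ_def P_def Q_def)
  have d2: "(S \<union> SP \<union> SQ) \<inter> extra_pairs A B E = {}"
    by (auto simp: S_def SP_def SQ_def P_def Q_def extra_pairs_def)
  have "card S + card SP + card SQ + card (extra_pairs A B E)
      = card (S \<union> SP \<union> SQ \<union> extra_pairs A B E)"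
    using d1 d2 f finite_extra_pairs[OF fin, of E] by (simp add: card_Un_disjoint)
  also have "\<dots> \<le> card (bad_pairs A B E)"
    by (rule card_mono[OF finite_bad_pairs[OF fin] sub])
  finally show ?thesis using cS cSP cSQ unfolding P_def Q_def by linarith
qed

lemma slack_inequality:
  assumes fin: "finite A" "finite B" and ne: "A \<noteq> {}" "B \<noteq> {}"
    and nf: "none_full A B E \<or> none_full B A E\<inverse>\<inverse>"
  shows "card (spread A B E) + card (spread B A E\<inverse>\<inverse>) + card A * card B
      + card (tight_pairs A B E) + card (extra_pairs A B E)
    \<le> card (bad_pairs A B E) + card A + card B
      + of_bool (none_full A B E) + of_bool (none_full B A E\<inverse>\<inverse>)"
proof -
  have "card (spread B A E\<inverse>\<inverse>) + card (tight_pairs A B E)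
    \<le> of_bool (none_full A B E) + card B + card {Y \<in> spread B A E\<inverse>\<inverse>. 2 \<le> card Y}"
    using card_spread_le[of B A "E\<inverse>\<inverse>"] fin nf
    by (auto simp: tight_pairs_conversep card_swap)
  then show ?thesis
    using card_spread_le[OF fin(1) nf] card_bad_pairs_ge[OF fin ne, of E] by linarith
qed

section \<open>Tight and extra pairs from non-full vertices\<close>

text \<open>
  With \<open>C\<close> the set of non-neighbours of \<open>v\<close>, the pair \<open>(A - {v}, C)\<close> is bad because it leaves \<open>v\<close>
  undominated. Its second component is never in \<open>spread\<close>, since \<open>v\<close> has no non-neighbour outside \<open>C\<close>;
  its first component is in \<open>spread\<close> only if \<open>C = B\<close>, and then \<open>C\<close> is not a singleton. Hence the pair
  is extra unless \<open>A - {v} = {u}\<close> and \<open>C = {w}\<close>, and in that case an edge between \<open>u\<close> and \<open>w\<close> is all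
  that \<open>(v, w)\<close> needs to be tight.
\<close>

lemma extra_or_tight:
  assumes fin: "finite A" "finite B" and two: "2 \<le> card A" "2 \<le> card B"
    and v: "v \<in> A" and nonfull: "\<exists>w\<in>B. \<not> E v w"
  shows "(A - {v}, {w \<in> B. \<not> E v w}) \<in> extra_pairs A B E \<or>
    (\<exists>u w. A = {u, v} \<and> {w \<in> B. \<not> E v w} = {w} \<and> (E u w \<longrightarrow> (v, w) \<in> tight_pairs A B E))"
proof -
  define C where "C = {w \<in> B. \<not> E v w}"
  have C: "C \<subseteq> B" "C \<noteq> {}" using nonfull by (auto simp: C_def)
  have cA: "card (A - {v}) \<ge> 1" using two v fin by simp
  then have A: "A - {v} \<noteq> {}" by force
  have bad: "(A - {v}, C) \<in> bad_pairs A B E"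
    using A C v by (auto simp: bad_pairs_def undominated_def C_def)
  have C_not_spread: "C \<notin> spread B A E\<inverse>\<inverse>"
    using v by (auto simp: spread_def C_def)
  have A_not_spread: "A - {v} \<notin> spread A B E" if "is_singleton C"
  proof
    assume "A - {v} \<in> spread A B E"
    then have "B = C" by (auto simp: spread_def C_def)
    then show False using that two by (simp add: is_singleton_altdef)
  qed
  show ?thesis
  proof (cases "is_singleton (A - {v}) \<and> is_singleton C")
    case False
    then show ?thesis
      using bad C_not_spread A_not_spread by (auto simp: extra_pairs_def C_def)
  next
    case True
    then obtain u w where u: "A - {v} = {u}" and w: "C = {w}" by (auto simp: is_singleton_def)
    have "A = {u, v}" using u v by auto
    moreover have "(v, w) \<in> tight_pairs A B E" if "E u w"
      using that u w v by (auto simp: tight_pairs_iff C_def)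
    ultimately show ?thesis using w by (auto simp: C_def)
  qed
qed

text \<open>
  Each \<open>v \<in> A\<close> contributes its own pair: \<open>v\<close> is the first entry of a tight pair or can be recovered
  from an extra pair as the only element missing from the first component.
\<close>

lemma card_le_tight_plus_extra:
  assumes fin: "finite A" "finite B" and two: "2 \<le> card A" "2 \<le> card B"
    and nf: "none_full A B E" and noniso: "none_isolated B A E\<inverse>\<inverse>"
  shows "card A \<le> card (tight_pairs A B E) + card (extra_pairs A B E)"
proof -
  have "A \<subseteq> fst ` tight_pairs A B E \<union> (\<lambda>(X, Y). the_elem (A - X)) ` extra_pairs A B E"
  proof
    fix v assume v: "v \<in> A"
    have "\<exists>w\<in>B. \<not> E v w" using nf v by (auto simp: none_full_def)
    from extra_or_tight[of A B v E, OF fin two v this]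
    show "v \<in> fst ` tight_pairs A B E \<union> (\<lambda>(X, Y). the_elem (A - X)) ` extra_pairs A B E"
    proof
      assume "(A - {v}, {w \<in> B. \<not> E v w}) \<in> extra_pairs A B E"
      moreover have "the_elem (A - (A - {v})) = v" using v by (simp add: double_diff)
      ultimately show ?thesis by (force simp: image_iff)
    next
      assume "\<exists>u w. A = {u, v} \<and> {w \<in> B. \<not> E v w} = {w} \<and> (E u w \<longrightarrow> (v, w) \<in> tight_pairs A B E)"
      then obtain u w where uw: "A = {u, v}" "{w \<in> B. \<not> E v w} = {w}"
        "E u w \<longrightarrow> (v, w) \<in> tight_pairs A B E" by blast
      then have "w \<in> B" "\<not> E v w" by auto
      then have "E u w" using noniso uw(1) by (auto simp: none_isolated_def)
      then show ?thesis using uw(3) by force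
    qed
  qed
  then have "card A \<le> card (fst ` tight_pairs A B E
      \<union> (\<lambda>(X, Y). the_elem (A - X)) ` extra_pairs A B E)"
    using finite_tight_pairs[OF fin, of E] finite_extra_pairs[OF fin, of E]
    by (intro card_mono) auto
  also have "\<dots> \<le> card (tight_pairs A B E) + card (extra_pairs A B E)"
    using finite_tight_pairs[OF fin, of E] finite_extra_pairs[OF fin, of E]
    by (meson add_mono card_Un_le card_image_le order_trans)
  finally show ?thesis .
qed

text \<open>
  For an isolated vertex \<open>v\<close> the set of non-neighbours is all of \<open>B\<close>, so the exceptional case of a
  single non-neighbour cannot occur.
\<close>

lemma card_extra_pairs_pos_if_isolated:
  assumes fin: "finite A" "finite B" and two: "2 \<le> card A" "2 \<le> card B"
    and iso: "\<not> none_isolated A B E"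
  shows "card (extra_pairs A B E) > 0"
proof -
  obtain v where v: "v \<in> A" "\<forall>w\<in>B. \<not> E v w" using iso by (auto simp: none_isolated_def)
  have B: "{w \<in> B. \<not> E v w} = B" using v by auto
  have "B \<noteq> {}" using two by auto
  then have "\<exists>w\<in>B. \<not> E v w" using v by auto
  from extra_or_tight[of A B v E, OF fin two v(1) this]
  have "(A - {v}, B) \<in> extra_pairs A B E" using two unfolding B by auto
  then show ?thesis using finite_extra_pairs[OF fin] by (auto simp: card_gt_0_iff)
qed

text \<open>
  Together with the slack inequality this excludes \<open>balanced\<close>. If a side has no full vertex and the
  other no isolated vertex, the tight and extra pairs number at least the size of the first side, and
  \<open>|A| |B|\<close> exceeds the size of the other side by at least 2; this suffices unless all four indicators
  are 1 and \<open>|A| = |B| = 2\<close>, the excluded matching. In the remaining combinations the indicator terms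
  sum to at most 2, so only \<open>|A| = |B| = 2\<close> needs an extra pair, which an isolated vertex provides.
\<close>

lemma strict_slack:
  assumes fin: "finite A" "finite B" and two: "2 \<le> card A" "2 \<le> card B"
    and nf: "none_full A B E \<or> none_full B A E\<inverse>\<inverse>"
    and not2K2: "\<not> (card A = 2 \<and> card B = 2 \<and> none_isolated A B E \<and> none_isolated B A E\<inverse>\<inverse>
        \<and> none_full A B E \<and> none_full B A E\<inverse>\<inverse>)"
  shows "card A + card B + of_bool (none_full A B E) + of_bool (none_full B A E\<inverse>\<inverse>)
      + of_bool (none_isolated A B E) + of_bool (none_isolated B A E\<inverse>\<inverse>)
    < card A * card B + card (tight_pairs A B E) + card (extra_pairs A B E) + 2"
proof -
  define k e where "k = card (tight_pairs A B E)" and "e = card (extra_pairs A B E)"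
  obtain a b where a: "card A = a + 2" and b: "card B = b + 2"
    using two by (metis add.commute le_Suc_ex)
  have sw: "card (tight_pairs B A E\<inverse>\<inverse>) = k" "card (extra_pairs B A E\<inverse>\<inverse>) = e"
    by (simp_all add: k_def e_def tight_pairs_conversep extra_pairs_conversep card_swap)
  have 1: "a + 2 \<le> k + e" if "none_full A B E" "none_isolated B A E\<inverse>\<inverse>"
    using card_le_tight_plus_extra[OF fin two that] a by (simp add: k_def e_def)
  have 2: "b + 2 \<le> k + e" if "none_full B A E\<inverse>\<inverse>" "none_isolated A B E"
    using card_le_tight_plus_extra[OF fin(2,1) two(2,1), of "E\<inverse>\<inverse>"] that b by (simp add: sw)
  have 3: "e > 0" if "\<not> none_isolated A B E"
    using card_extra_pairs_pos_if_isolated[OF fin two that] by (simp add: e_def)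
  have 4: "e > 0" if "\<not> none_isolated B A E\<inverse>\<inverse>"
    using card_extra_pairs_pos_if_isolated[OF fin(2,1) two(2,1) that] by (simp add: sw)
  have "a + b + of_bool (none_full A B E) + of_bool (none_full B A E\<inverse>\<inverse>)
      + of_bool (none_isolated A B E) + of_bool (none_isolated B A E\<inverse>\<inverse>)
    < a * b + 2 * a + 2 * b + 2 + k + e"
    using 1 2 3 4 nf not2K2 unfolding a b
    by (cases "none_full A B E"; cases "none_full B A E\<inverse>\<inverse>"; cases "none_isolated A B E";
        cases "none_isolated B A E\<inverse>\<inverse>") (auto simp: not_less)
  then show ?thesis unfolding a b k_def[symmetric] e_def[symmetric] by (simp add: algebra_simps)
qed

section \<open>Characterization of balanced relations\<close>

text \<open>
  With a single vertex \<open>v\<close> on one side, \<open>({v}, Y)\<close> is bad exactly when \<open>Y\<close> is a nonempty member of the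
  \<open>spread\<close> family of \<open>B\<close>. What remains is complementary: \<open>v\<close> is isolated or not, and \<open>v\<close> is full or
  not, each alternative contributing 1.
\<close>

lemma balanced_if_singleton:
  assumes A: "A = {v}" and fin: "finite B" and ne: "B \<noteq> {}"
  shows "balanced A B E"
proof -
  define Q where "Q = {Y. Y \<subseteq> B \<and> Y \<noteq> {} \<and> (\<exists>w\<in>B - Y. \<not> E v w)}"
  have fQ: "finite Q" by (rule finite_subset[of _ "Pow B"]) (use fin in \<open>auto simp: Q_def\<close>)
  have "bad_pairs A B E = Pair {v} ` Q"
    by (auto simp: bad_pairs_def undominated_def A Q_def subset_singleton_iff)
  then have bad: "card (bad_pairs A B E) = card Q" by (simp add: card_image inj_on_def)
  have "spread B A E\<inverse>\<inverse> = (if \<exists>w\<in>B. \<not> E v w then insert {} Q else Q)"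
    by (auto simp: spread_def A Q_def)
  then have q: "card (spread B A E\<inverse>\<inverse>) = card Q + of_bool (\<exists>w\<in>B. \<not> E v w)"
    using fQ by (auto simp: Q_def)
  have "spread A B E = (if \<exists>w\<in>B. E v w then {} else {{}})"
    using ne by (auto simp: spread_def A subset_singleton_iff)
  then have p: "card (spread A B E) = of_bool (\<not> (\<exists>w\<in>B. E v w))" by simp
  have "none_isolated A B E \<longleftrightarrow> (\<exists>w\<in>B. E v w)" "none_isolated B A E\<inverse>\<inverse> \<longleftrightarrow> \<not> (\<exists>w\<in>B. \<not> E v w)"
    by (auto simp: none_isolated_def A)
  then show ?thesis by (simp add: balanced_def bad p q)
qed

lemma balanced_if_complete:
  assumes "\<forall>v\<in>A. \<forall>w\<in>B. E v w" "A \<noteq> {}" "B \<noteq> {}"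
  shows "balanced A B E"
proof -
  have "spread A B E = {}" "spread B A E\<inverse>\<inverse> = {}" "bad_pairs A B E = {}"
    using assms by (auto simp: spread_def bad_pairs_def undominated_def)
  moreover have "none_isolated A B E" "none_isolated B A E\<inverse>\<inverse>"
    using assms by (auto simp: none_isolated_def)
  ultimately show ?thesis by (simp add: balanced_def)
qed

text \<open>
  On two vertices per side, having no full and no isolated vertex means that every vertex has
  exactly one neighbour, so the relation is a perfect matching.
\<close>

lemma matching_of_two_by_two:
  assumes two: "card A = 2" "card B = 2"
    and t: "none_isolated A B E" "none_isolated B A E\<inverse>\<inverse>"
    and n: "none_full A B E" "none_full B A E\<inverse>\<inverse>"
  obtains v1 v2 w1 w2 where "A = {v1, v2}" "v1 \<noteq> v2" "B = {w1, w2}" "w1 \<noteq> w2"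
    "E v1 w1" "E v2 w2" "\<not> E v1 w2" "\<not> E v2 w1"
proof -
  obtain v1 v2 where A: "A = {v1, v2}" "v1 \<noteq> v2" using two by (auto simp: card_2_iff)
  obtain w1 w2 where w: "w1 \<in> B" "E v1 w1" "w2 \<in> B" "\<not> E v1 w2"
    using t n A by (auto simp: none_isolated_def none_full_def)
  then have B: "B = {w1, w2}" "w1 \<noteq> w2" using two by (auto simp: card_2_iff)
  show ?thesis using that[OF A B] t n w A B by (auto simp: none_isolated_def none_full_def)
qed

lemma balanced_if_two_K2:
  assumes "card A = 2" "card B = 2" "none_isolated A B E" "none_isolated B A E\<inverse>\<inverse>"
    "none_full A B E" "none_full B A E\<inverse>\<inverse>"
  shows "balanced A B E"
proof -
  from matching_of_two_by_two[OF assms] obtain v1 v2 w1 w2 where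
    A: "A = {v1, v2}" "v1 \<noteq> v2" and B: "B = {w1, w2}" "w1 \<noteq> w2" and
    E: "E v1 w1" "E v2 w2" "\<not> E v1 w2" "\<not> E v2 w1" .
  have sub: "X \<subseteq> {x, y} \<longleftrightarrow> X = {} \<or> X = {x} \<or> X = {y} \<or> X = {x, y}" for X and x y :: 'c
    by auto
  have "spread A B E = {{}}" using A B E by (auto simp: spread_def sub)
  moreover have "spread B A E\<inverse>\<inverse> = {{}}" using A B E by (auto simp: spread_def sub)
  moreover have "bad_pairs A B E = {({v1}, {w1}), ({v2}, {w2})}"
    using A B E by (auto simp: bad_pairs_def undominated_def sub)
  ultimately show ?thesis using assms A by (simp add: balanced_def)
qed

theorem balanced_iff:
  assumes fin: "finite A" "finite B" and ne: "A \<noteq> {}" "B \<noteq> {}"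
  shows "balanced A B E \<longleftrightarrow> card A = 1 \<or> card B = 1
    \<or> (card A = 2 \<and> card B = 2 \<and> none_isolated A B E \<and> none_isolated B A E\<inverse>\<inverse>
        \<and> none_full A B E \<and> none_full B A E\<inverse>\<inverse>)
    \<or> (\<forall>v\<in>A. \<forall>w\<in>B. E v w)" (is "_ \<longleftrightarrow> ?a \<or> ?b \<or> ?m \<or> ?c")
proof
  assume bal: "balanced A B E"
  show "?a \<or> ?b \<or> ?m \<or> ?c"
  proof (rule ccontr)
    assume neg: "\<not> (?a \<or> ?b \<or> ?m \<or> ?c)"
    have "card A > 0" "card B > 0" using fin ne by (auto simp: card_gt_0_iff)
    then have two: "2 \<le> card A" "2 \<le> card B" using neg by linarith+
    show False
    proof (cases "none_full A B E \<or> none_full B A E\<inverse>\<inverse>")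
      case True
      have "\<not> ?m" using neg by blast
      from slack_inequality[OF fin ne True] strict_slack[OF fin two True this]
      show False using bal unfolding balanced_def by linarith
    next
      case False
      \<comment> \<open>A full vertex on each side empties both families, so one bad pair is already too many.\<close>
      then have "spread A B E = {}" "spread B A E\<inverse>\<inverse> = {}"
        by (auto simp: spread_def none_full_def)
      moreover obtain v w where vw: "v \<in> A" "w \<in> B" "\<not> E v w" using neg by blast
      have "card (A - {v}) \<ge> 1" using two(1) vw(1) fin by simp
      then have "A - {v} \<noteq> {}" by force
      then have "(A - {v}, {w}) \<in> bad_pairs A B E"
        using vw by (auto simp: bad_pairs_def undominated_def)
      then have "card (bad_pairs A B E) > 0"
        using finite_bad_pairs[OF fin] by (auto simp: card_gt_0_iff)
      ultimately show False using bal by (auto simp: balanced_def of_bool_def split: if_splits)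
    qed
  qed
next
  assume "?a \<or> ?b \<or> ?m \<or> ?c"
  then consider ?a | ?b | ?m | ?c by blast
  then show "balanced A B E"
  proof cases
    case 1
    then obtain v where "A = {v}" by (auto simp: card_1_singleton_iff)
    then show ?thesis by (rule balanced_if_singleton[OF _ fin(2) ne(2)])
  next
    case 2
    then obtain w where "B = {w}" by (auto simp: card_1_singleton_iff)
    then have "balanced B A E\<inverse>\<inverse>" by (rule balanced_if_singleton[OF _ fin(1) ne(1)])
    then show ?thesis by (simp add: balanced_conversep)
  next
    case 3
    then show ?thesis by (intro balanced_if_two_K2) simp_all
  next
    case 4
    then show ?thesis by (rule balanced_if_complete[OF _ ne])
  qed
qed

section \<open>Dominating sets of a bipartite graph and of its complement\<close>

lemma card_union_decompose:
  assumes "A \<inter> B = {}"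
  shows "card {S. S \<subseteq> A \<union> B \<and> P S} = card {(X, Y). X \<subseteq> A \<and> Y \<subseteq> B \<and> P (X \<union> Y)}"
proof -
  have "bij_betw (\<lambda>(X, Y). X \<union> Y) {(X, Y). X \<subseteq> A \<and> Y \<subseteq> B \<and> P (X \<union> Y)} {S. S \<subseteq> A \<union> B \<and> P S}"
  proof (rule bij_betw_byWitness[where f' = "\<lambda>S. (S \<inter> A, S \<inter> B)"])
    show "\<forall>a\<in>{(X, Y). X \<subseteq> A \<and> Y \<subseteq> B \<and> P (X \<union> Y)}.
        (\<lambda>S. (S \<inter> A, S \<inter> B)) ((\<lambda>(X, Y). X \<union> Y) a) = a"
      using assms by auto
    have "S \<inter> A \<union> S \<inter> B = S" if "S \<subseteq> A \<union> B" for S using that by blast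
    then show "\<forall>S\<in>{S. S \<subseteq> A \<union> B \<and> P S}.
        (\<lambda>(X, Y). X \<union> Y) ((\<lambda>S. (S \<inter> A, S \<inter> B)) S) = S"
      and "(\<lambda>S. (S \<inter> A, S \<inter> B)) ` {S. S \<subseteq> A \<union> B \<and> P S}
        \<subseteq> {(X, Y). X \<subseteq> A \<and> Y \<subseteq> B \<and> P (X \<union> Y)}"
      by auto
    show "(\<lambda>(X, Y). X \<union> Y) ` {(X, Y). X \<subseteq> A \<and> Y \<subseteq> B \<and> P (X \<union> Y)}
        \<subseteq> {S. S \<subseteq> A \<union> B \<and> P S}" by auto
  qed
  then show ?thesis by (simp add: bij_betw_same_card)
qed

lemma card_nonempty_pairs:
  assumes "finite A" "finite B"
  shows "card ((Pow A - {{}}) \<times> (Pow B - {{}})) = (2 ^ card A - 1) * (2 ^ card B - 1)"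
  using assms by (simp add: card_cartesian_product card_Diff_singleton card_Pow)

lemma card_pairs_split:
  assumes fin: "finite A" "finite B" and ne: "\<not> P {} {}"
  shows "card {(X, Y). X \<subseteq> A \<and> Y \<subseteq> B \<and> P X Y}
    = card {(X, Y). X \<subseteq> A \<and> Y \<subseteq> B \<and> X \<noteq> {} \<and> Y \<noteq> {} \<and> P X Y}
      + card {X. X \<subseteq> A \<and> P X {}} + card {Y. Y \<subseteq> B \<and> P {} Y}"
proof -
  define N where "N = {(X, Y). X \<subseteq> A \<and> Y \<subseteq> B \<and> X \<noteq> {} \<and> Y \<noteq> {} \<and> P X Y}"
  define SX where "SX = {X. X \<subseteq> A \<and> P X {}}"
  define SY where "SY = {Y. Y \<subseteq> B \<and> P {} Y}"
  have f: "finite SX" "finite SY" "finite N"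
    using fin by (auto simp: SX_def SY_def N_def intro: finite_subset[of _ "Pow A \<times> Pow B"])
  have "{(X, Y). X \<subseteq> A \<and> Y \<subseteq> B \<and> P X Y} = N \<union> (\<lambda>X. (X, {})) ` SX \<union> Pair {} ` SY"
    by (auto simp: N_def SX_def SY_def)
  also have "card \<dots> = card N + card ((\<lambda>X. (X, {} :: 'b set)) ` SX) + card (Pair ({} :: 'a set) ` SY)"
    using f ne by (subst card_Un_disjoint, auto simp: N_def SX_def SY_def)+
  also have "\<dots> = card N + card SX + card SY"
    by (simp add: card_image inj_on_def)
  finally show ?thesis unfolding N_def SX_def SY_def .
qed

lemma card_spread_complement:
  "card (spread A B E) = card {X. X \<subseteq> A \<and> (\<forall>w\<in>B. \<exists>v\<in>X. \<not> E v w)}"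
proof -
  have "bij_betw (\<lambda>X. A - X) (spread A B E) {X. X \<subseteq> A \<and> (\<forall>w\<in>B. \<exists>v\<in>X. \<not> E v w)}"
    by (rule bij_betw_byWitness[where f' = "\<lambda>X. A - X"]) (auto simp: spread_def double_diff)
  then show ?thesis by (rule bij_betw_same_card)
qed

lemma sum_of_counts_iff:
  fixes d d' bad p q s t m n :: nat
  assumes d: "d + bad = (2 ^ m - 1) * (2 ^ n - 1) + s + t"
    and d': "d' = (2 ^ m - 1) * (2 ^ n - 1) + p + q"
  shows "int d + int d' = 2 * (2 ^ m - 1) * (2 ^ n - 1) + 2 \<longleftrightarrow> p + q + s + t = bad + 2"
proof -
  define M :: nat where "M = (2 ^ m - 1) * (2 ^ n - 1)"
  have "int (2 ^ k - 1) = 2 ^ k - 1" for k :: nat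
    using of_nat_diff[of 1 "2 ^ k :: nat", where ?'a = int] by simp
  then have "2 * (2 ^ m - 1) * (2 ^ n - 1) + 2 = 2 * int M + 2"
    by (simp add: M_def)
  moreover have "int d + int bad = int M + int s + int t" "int d' = int M + int p + int q"
    using d d' unfolding M_def[symmetric] by linarith+
  ultimately show ?thesis by linarith
qed

locale bipartitioned_graph =
  fixes G :: "'a pair_pre_digraph" and A B :: "'a set"
  assumes graph: "pair_graph G" and bip: "nonempty_bipartition G A B"
begin

sublocale pair_graph G by (rule graph)

definition E where "E v w \<longleftrightarrow> (v, w) \<in> parcs G"

lemma parts: "pverts G = A \<union> B" "A \<inter> B = {}" "A \<noteq> {}" "B \<noteq> {}"
  and no_arc: "u \<in> A \<Longrightarrow> v \<in> A \<Longrightarrow> \<not> E u v" "u \<in> B \<Longrightarrow> v \<in> B \<Longrightarrow> \<not> E u v"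
  using bip by (auto simp: nonempty_bipartition_def E_def)

lemma finite_parts: "finite A" "finite B"
  using pair_finite_verts parts by auto

lemma arc_sym: "E u v \<longleftrightarrow> E v u"
  using pair_sym_arcs by (auto simp: symmetric_def E_def elim: symE)

lemma dominating_iff:
  assumes "X \<subseteq> A" "Y \<subseteq> B"
  shows "dominating G (X \<union> Y) \<longleftrightarrow> \<not> undominated A B E X Y"
proof -
  have XY: "X \<union> Y \<subseteq> pverts G" "A - (X \<union> Y) = A - X" "B - (X \<union> Y) = B - Y"
    using assms parts by auto
  have a: "(\<exists>u\<in>X \<union> Y. E v u) \<longleftrightarrow> (\<exists>u\<in>Y. E v u)" if "v \<in> A" for v
    using that assms no_arc by blast
  have b: "(\<exists>u\<in>X \<union> Y. E v u) \<longleftrightarrow> (\<exists>u\<in>X. E u v)" if "v \<in> B" for v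
  proof -
    have "(\<exists>u\<in>X \<union> Y. E v u) \<longleftrightarrow> (\<exists>u\<in>X. E v u)" using that assms no_arc by blast
    also have "\<dots> \<longleftrightarrow> (\<exists>u\<in>X. E u v)" by (rule bex_cong[OF refl arc_sym])
    finally show ?thesis .
  qed
  have "dominating G (X \<union> Y) \<longleftrightarrow>
      (\<forall>v\<in>A - X. \<exists>u\<in>X \<union> Y. E v u) \<and> (\<forall>v\<in>B - Y. \<exists>u\<in>X \<union> Y. E v u)"
    using XY unfolding dominating_def parts(1) E_def by blast
  also have "\<dots> \<longleftrightarrow> \<not> undominated A B E X Y"
    using a b by (auto simp: undominated_def)
  finally show ?thesis .
qed

text \<open>
  Both parts are cliques of the complement, so a set meeting a part dominates that part; only a part
  that the set misses imposes a condition.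
\<close>

lemma complement_dominating_iff:
  assumes "X \<subseteq> A" "Y \<subseteq> B"
  shows "dominating (graph_complement G) (X \<union> Y) \<longleftrightarrow>
    (X = {} \<longrightarrow> (\<forall>v\<in>A. \<exists>w\<in>Y. \<not> E v w)) \<and> (Y = {} \<longrightarrow> (\<forall>w\<in>B. \<exists>v\<in>X. \<not> E v w))"
proof -
  define D where "D v \<longleftrightarrow> v \<in> X \<union> Y \<or> (\<exists>u\<in>X \<union> Y. v \<noteq> u \<and> \<not> E v u)" for v
  have XY: "X \<union> Y \<subseteq> A \<union> B" using assms by auto
  have "dominating (graph_complement G) (X \<union> Y) \<longleftrightarrow> (\<forall>v\<in>A \<union> B. D v)"
  proof -
    have "(v, u) \<in> parcs (graph_complement G) \<longleftrightarrow> v \<noteq> u \<and> \<not> E v u"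
      if "v \<in> A \<union> B" "u \<in> X \<union> Y" for u v
      using that XY by (auto simp: graph_complement_def parts(1) E_def)
    moreover have "pverts (graph_complement G) = A \<union> B"
      by (simp add: graph_complement_def parts(1))
    ultimately show ?thesis
      using XY unfolding dominating_def D_def by simp
  qed
  moreover have D_iff: "D v \<longleftrightarrow> (X' = {} \<longrightarrow> (\<exists>w\<in>Y'. \<not> E v w))"
    if "v \<in> C" "X' \<subseteq> C" "Y' \<inter> C = {}" "X \<union> Y = X' \<union> Y'" "\<And>x. x \<in> C \<Longrightarrow> \<not> E v x" for v C X' Y'
  proof (cases "X' = {}")
    case True
    then show ?thesis using that(1,3) by (auto simp: D_def that(4))
  next
    case False
    then obtain x where x: "x \<in> X'" by blast
    then have "\<not> E v x" using that(2,5) by blast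
    then have "D v" using x by (cases "v = x") (auto simp: D_def that(4))
    then show ?thesis using False by simp
  qed
  moreover have "D v \<longleftrightarrow> (X = {} \<longrightarrow> (\<exists>w\<in>Y. \<not> E v w))" if "v \<in> A" for v
    by (rule D_iff[OF that assms(1)]) (use assms parts(2) no_arc that in auto)
  moreover have "D w \<longleftrightarrow> (Y = {} \<longrightarrow> (\<exists>v\<in>X. \<not> E v w))" if "w \<in> B" for w
  proof -
    have "D w \<longleftrightarrow> (Y = {} \<longrightarrow> (\<exists>v\<in>X. \<not> E w v))"
      by (rule D_iff[OF that assms(2)]) (use assms parts(2) no_arc that in auto)
    then show ?thesis by (simp add: arc_sym[of w])
  qed
  ultimately show ?thesis by auto
qed

lemma num_dominating_graph:
  "num_dominating G + card (bad_pairs A B E)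
    = (2 ^ card A - 1) * (2 ^ card B - 1)
      + of_bool (none_isolated A B E) + of_bool (none_isolated B A E\<inverse>\<inverse>)"
proof -
  define N where "N = {(X, Y). X \<subseteq> A \<and> Y \<subseteq> B \<and> X \<noteq> {} \<and> Y \<noteq> {} \<and> \<not> undominated A B E X Y}"
  have "num_dominating G = card {S. S \<subseteq> A \<union> B \<and> dominating G S}"
    unfolding num_dominating_def dominating_def parts(1) by (rule arg_cong[of _ _ card]) auto
  also have "\<dots> = card {(X, Y). X \<subseteq> A \<and> Y \<subseteq> B \<and> dominating G (X \<union> Y)}"
    by (rule card_union_decompose[OF parts(2)])
  also have "{(X, Y). X \<subseteq> A \<and> Y \<subseteq> B \<and> dominating G (X \<union> Y)}
      = {(X, Y). X \<subseteq> A \<and> Y \<subseteq> B \<and> \<not> undominated A B E X Y}"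
    using dominating_iff by blast
  also have "card \<dots> = card N + card {X. X \<subseteq> A \<and> \<not> undominated A B E X {}}
      + card {Y. Y \<subseteq> B \<and> \<not> undominated A B E {} Y}"
    unfolding N_def
    using parts finite_parts by (intro card_pairs_split) (auto simp: undominated_def)
  also have "card {X. X \<subseteq> A \<and> \<not> undominated A B E X {}} = of_bool (none_isolated B A E\<inverse>\<inverse>)"
  proof -
    have "{X. X \<subseteq> A \<and> \<not> undominated A B E X {}} = (if none_isolated B A E\<inverse>\<inverse> then {A} else {})"
      by (auto simp: undominated_def none_isolated_def) blast+
    then show ?thesis by simp
  qed
  also have "card {Y. Y \<subseteq> B \<and> \<not> undominated A B E {} Y} = of_bool (none_isolated A B E)"
  proof -
    have "{Y. Y \<subseteq> B \<and> \<not> undominated A B E {} Y} = (if none_isolated A B E then {B} else {})"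
      by (auto simp: undominated_def none_isolated_def)
    then show ?thesis by simp
  qed
  finally have "num_dominating G = card N + of_bool (none_isolated B A E\<inverse>\<inverse>) + of_bool (none_isolated A B E)" .
  moreover have "card N + card (bad_pairs A B E) = (2 ^ card A - 1) * (2 ^ card B - 1)"
  proof -
    have "finite N"
      by (rule finite_subset[of _ "Pow A \<times> Pow B"]) (use finite_parts in \<open>auto simp: N_def\<close>)
    then have "card N + card (bad_pairs A B E) = card (N \<union> bad_pairs A B E)"
      using finite_bad_pairs[OF finite_parts, of E]
      by (subst card_Un_disjoint) (auto simp: N_def bad_pairs_def)
    also have "N \<union> bad_pairs A B E = (Pow A - {{}}) \<times> (Pow B - {{}})"
      by (auto simp: N_def bad_pairs_def)
    finally show ?thesis by (simp add: card_nonempty_pairs[OF finite_parts])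
  qed
  ultimately show ?thesis by linarith
qed

lemma num_dominating_complement:
  "num_dominating (graph_complement G)
    = (2 ^ card A - 1) * (2 ^ card B - 1) + card (spread A B E) + card (spread B A E\<inverse>\<inverse>)"
proof -
  let ?H = "graph_complement G"
  define P where "P X Y \<longleftrightarrow> (X = {} \<longrightarrow> (\<forall>v\<in>A. \<exists>w\<in>Y. \<not> E v w)) \<and>
    (Y = {} \<longrightarrow> (\<forall>w\<in>B. \<exists>v\<in>X. \<not> E v w))" for X Y
  have complement: "X \<subseteq> A \<and> Y \<subseteq> B \<and> dominating ?H (X \<union> Y) \<longleftrightarrow> X \<subseteq> A \<and> Y \<subseteq> B \<and> P X Y" for X Y
    using complement_dominating_iff[of X Y] by (simp add: P_def cong: conj_cong)
  have "num_dominating ?H = card {S. S \<subseteq> A \<union> B \<and> dominating ?H S}"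
    unfolding num_dominating_def dominating_def
    by (rule arg_cong[of _ _ card]) (auto simp: graph_complement_def parts(1))
  also have "\<dots> = card {(X, Y). X \<subseteq> A \<and> Y \<subseteq> B \<and> dominating ?H (X \<union> Y)}"
    by (rule card_union_decompose[OF parts(2)])
  also have "{(X, Y). X \<subseteq> A \<and> Y \<subseteq> B \<and> dominating ?H (X \<union> Y)}
      = {(X, Y). X \<subseteq> A \<and> Y \<subseteq> B \<and> P X Y}"
    by (simp only: complement)
  also have "card \<dots> = card {(X, Y). X \<subseteq> A \<and> Y \<subseteq> B \<and> X \<noteq> {} \<and> Y \<noteq> {} \<and> P X Y}
      + card {X. X \<subseteq> A \<and> P X {}} + card {Y. Y \<subseteq> B \<and> P {} Y}"
    using parts finite_parts by (intro card_pairs_split) (auto simp: P_def)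
  also have "{(X, Y). X \<subseteq> A \<and> Y \<subseteq> B \<and> X \<noteq> {} \<and> Y \<noteq> {} \<and> P X Y} = (Pow A - {{}}) \<times> (Pow B - {{}})"
    by (auto simp: P_def)
  also have "{X. X \<subseteq> A \<and> P X {}} = {X. X \<subseteq> A \<and> (\<forall>w\<in>B. \<exists>v\<in>X. \<not> E v w)}"
    using parts by (auto simp: P_def)
  also have "{Y. Y \<subseteq> B \<and> P {} Y} = {Y. Y \<subseteq> B \<and> (\<forall>v\<in>A. \<exists>w\<in>Y. \<not> E\<inverse>\<inverse> w v)}"
    using parts by (auto simp: P_def)
  finally show ?thesis
    by (simp only: card_spread_complement card_nonempty_pairs[OF finite_parts])
qed

lemma domination_sum_iff_balanced:
  "int (num_dominating G) + int (num_dominating (graph_complement G))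
      = 2 * (2 ^ card A - 1) * (2 ^ card B - 1) + 2 \<longleftrightarrow> balanced A B E"
  unfolding balanced_def
  by (rule sum_of_counts_iff[OF num_dominating_graph num_dominating_complement])

text \<open>
  The complete bipartite structure may be witnessed by an unrelated pair \<open>(U, V)\<close>. Since both parts
  are nonempty, the graph is connected, so its bipartition is unique up to exchanging the sides.
\<close>

lemma complete_bipartite_iff:
  "K\<^bsub>card A,card B\<^esub> (with_proj G) \<longleftrightarrow> (\<forall>v\<in>A. \<forall>w\<in>B. E v w)"
proof
  assume "K\<^bsub>card A,card B\<^esub> (with_proj G)"
  then obtain U V where UV: "pverts G = U \<union> V" "U \<inter> V = {}" "card U = card A" "card V = card B"
    "parcs G = U \<times> V \<union> V \<times> U"
    unfolding complete_bipartite_digraph_pair_def by (elim conjE exE)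
  have ne: "U \<noteq> {}" "V \<noteq> {}"
    using UV(3,4) parts(3,4) finite_parts by auto
  have "U = A \<and> V = B \<or> U = B \<and> V = A"
  proof -
    obtain u v where uv: "u \<in> U" "v \<in> V" using ne by blast
    have arc: "E x y" "E y x" if "x \<in> U" "y \<in> V" for x y using that UV by (auto simp: E_def)
    have cover: "x \<in> A \<or> x \<in> B" if "x \<in> U \<union> V" for x using that UV(1) parts(1) by blast
    have one_side: "U = C \<and> V = D"
      if C: "u \<in> C" and CD: "C \<union> D = U \<union> V" "C \<inter> D = {}"
        and indep: "\<And>x y. x \<in> C \<Longrightarrow> y \<in> C \<Longrightarrow> \<not> E x y" "\<And>x y. x \<in> D \<Longrightarrow> y \<in> D \<Longrightarrow> \<not> E x y"
      for C D
    proof -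
      have V: "V \<subseteq> D" using C CD(1) indep(1) uv(1) arc(1) by blast
      have U: "U \<subseteq> C" using V CD(1) indep(2) uv(2) arc(1) by blast
      show ?thesis using U V CD by blast
    qed
    have "A \<union> B = U \<union> V" "B \<union> A = U \<union> V" "B \<inter> A = {}" using UV(1) parts(1,2) by auto
    then show ?thesis
      using one_side[of A B] one_side[of B A] cover[of u] uv(1) parts(2) no_arc by blast
  qed
  then show "\<forall>v\<in>A. \<forall>w\<in>B. E v w" using UV(5) unfolding E_def by blast
next
  assume c: "\<forall>v\<in>A. \<forall>w\<in>B. E v w"
  have "parcs G = A \<times> B \<union> B \<times> A"
  proof (intro equalityI subrelI)
    fix u v assume "(u, v) \<in> parcs G"
    then have "u \<in> A \<union> B" "v \<in> A \<union> B" "\<not> (u \<in> A \<and> v \<in> A)" "\<not> (u \<in> B \<and> v \<in> B)"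
      using wellformed' parts no_arc by (auto simp: E_def)
    then show "(u, v) \<in> A \<times> B \<union> B \<times> A" by blast
  qed (use c arc_sym in \<open>auto simp: E_def\<close>)
  then show "K\<^bsub>card A,card B\<^esub> (with_proj G)"
    unfolding complete_bipartite_digraph_pair_def using parts pair_finite_verts by blast
qed

text \<open>
  In \<open>2K\<^sub>2\<close> every vertex has exactly one neighbour; under a bipartition with two vertices on each
  side, that neighbour lies on the opposite side, where one vertex remains as a non-neighbour.
\<close>

lemma two_K2_iff:
  assumes two: "card A = 2" "card B = 2"
  shows "digraph_iso (with_proj G) (with_proj two_K2) \<longleftrightarrow>
    none_isolated A B E \<and> none_isolated B A E\<inverse>\<inverse> \<and> none_full A B E \<and> none_full B A E\<inverse>\<inverse>"
    (is "_ \<longleftrightarrow> ?matching")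
proof
  assume "digraph_iso (with_proj G) (with_proj two_K2)"
  then obtain h where h: "digraph_isomorphism h" "with_proj two_K2 = app_iso h (with_proj G)"
    by (auto simp: digraph_iso_def)
  define f where "f = iso_verts h"
  have inj: "inj_on f (pverts G)"
    using h(1) by (auto simp: f_def digraph_isomorphism_def)
  have verts: "f ` pverts G = {0, 1, 2, 3}"
    using arg_cong[OF h(2), of verts] by (simp add: f_def two_K2_def)
  have arcs: "parcs two_K2 = (\<lambda>(u, v). (f u, f v)) ` parcs G"
    using arg_cong[OF h(2), of arcs_ends] arcs_ends_app_iso_eq[OF h(1)] by (simp add: f_def)
  have arc_iff: "E u v \<longleftrightarrow> (f u, f v) \<in> parcs two_K2" if "u \<in> pverts G" "v \<in> pverts G" for u v
  proof
    assume "(f u, f v) \<in> parcs two_K2"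
    then obtain a b where ab: "(a, b) \<in> parcs G" "f u = f a" "f v = f b" unfolding arcs by auto
    then have "u = a" "v = b" using that inj wellformed' by (auto intro: inj_onD)
    then show "E u v" using ab by (simp add: E_def)
  qed (auto simp: arcs E_def)
  have unique: "\<exists>!v. v \<in> pverts G \<and> E u v" if u: "u \<in> pverts G" for u
  proof -
    have "f u \<in> {0, 1, 2, 3}" using u verts by blast
    then have "\<exists>!y. y \<in> f ` pverts G \<and> (f u, y) \<in> parcs two_K2"
      unfolding verts by (auto simp: two_K2_def)
    then obtain y where y: "y \<in> f ` pverts G" "(f u, y) \<in> parcs two_K2"
      and y_unique: "\<And>z. z \<in> f ` pverts G \<Longrightarrow> (f u, z) \<in> parcs two_K2 \<Longrightarrow> z = y" by blast
    obtain v where v: "v \<in> pverts G" "y = f v" using y by blast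
    show ?thesis
    proof (rule ex1I[of _ v])
      show "v \<in> pverts G \<and> E u v" using v y u arc_iff by blast
      fix v' assume v': "v' \<in> pverts G \<and> E u v'"
      then have "f v' = f v" using y_unique[of "f v'"] arc_iff u v by blast
      then show "v' = v" using inj v v' by (auto dest: inj_onD)
    qed
  qed
  have side: "\<exists>w\<in>D. E u w" "\<exists>w\<in>D. \<not> E u w"
    if "u \<in> C" "C \<union> D = pverts G" "card D = 2" "\<forall>x\<in>C. \<forall>y\<in>C. \<not> E x y" for u C D
  proof -
    have u: "u \<in> pverts G" using that by blast
    show "\<exists>w\<in>D. E u w" using unique[OF u] that by blast
    obtain x y where "D = {x, y}" "x \<noteq> y" using \<open>card D = 2\<close> by (auto simp: card_2_iff)
    then show "\<exists>w\<in>D. \<not> E u w" using unique[OF u] that(2) by blast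
  qed
  have A: "\<exists>w\<in>B. E v w" "\<exists>w\<in>B. \<not> E v w" if "v \<in> A" for v
    using side[of v A B] that parts two no_arc by auto
  have B: "\<exists>w\<in>A. E v w" "\<exists>w\<in>A. \<not> E v w" if "v \<in> B" for v
    using side[of v B A] that parts two no_arc by auto
  show ?matching using A B arc_sym by (auto simp: none_isolated_def none_full_def)
next
  assume ?matching
  then obtain v1 v2 w1 w2 where A: "A = {v1, v2}" "v1 \<noteq> v2" and B: "B = {w1, w2}" "w1 \<noteq> w2"
    and e: "E v1 w1" "E v2 w2" "\<not> E v1 w2" "\<not> E v2 w1"
    using matching_of_two_by_two[OF two, of E] by metis
  have dis: "v1 \<noteq> w1" "v1 \<noteq> w2" "v2 \<noteq> w1" "v2 \<noteq> w2" using A B parts(2) by auto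
  have parcs: "parcs G = {(v1, w1), (w1, v1), (v2, w2), (w2, v2)}"
  proof (intro equalityI subrelI)
    fix u v assume uv: "(u, v) \<in> parcs G"
    then have "u \<in> A \<union> B" "v \<in> A \<union> B" "\<not> (u \<in> A \<and> v \<in> A)" "\<not> (u \<in> B \<and> v \<in> B)"
      using wellformed' parts no_arc by (auto simp: E_def)
    then show "(u, v) \<in> {(v1, w1), (w1, v1), (v2, w2), (w2, v2)}"
      using uv e arc_sym unfolding A B E_def by blast
  qed (use e arc_sym in \<open>auto simp: E_def\<close>)
  define f :: "'a \<Rightarrow> nat" where
    "f x = (if x = v1 then 0 else if x = w1 then 1 else if x = v2 then 2 else 3)" for x
  have f: "f v1 = 0" "f w1 = 1" "f v2 = 2" "f w2 = 3"
    using A B dis by (auto simp: f_def)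
  have inj: "inj_on f (pverts G)"
    unfolding parts(1) A B by (auto simp: inj_on_def f)
  define h where "h = \<lparr>iso_verts = f, iso_arcs = map_prod f f, iso_head = snd, iso_tail = fst\<rparr>"
  have "inj_on (map_prod f f) (parcs G)"
    unfolding parcs by (auto simp: inj_on_def f)
  then have "digraph_isomorphism h"
    using inj wf_digraph_axioms by (simp add: digraph_isomorphism_def h_def)
  moreover have "with_proj two_K2 = app_iso h (with_proj G)"
    by (simp add: app_iso_def h_def with_proj_def two_K2_def parcs parts(1) A B f insert_commute)
  ultimately show "digraph_iso (with_proj G) (with_proj two_K2)"
    by (auto simp: digraph_iso_def)
qed

end

theorem theorem3p1:
  fixes G :: "'a pair_pre_digraph" and A B :: "'a set"
  assumes "pair_graph G"
    and "nonempty_bipartition G A B"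
  shows "int (num_dominating G) + int (num_dominating (graph_complement G))
           = 2 * (2 ^ card A - 1) * (2 ^ card B - 1) + 2
     \<longleftrightarrow> min (card A) (card B) = 1
       \<or> card A = 2 \<and> card B = 2 \<and> digraph_iso (with_proj G) (with_proj two_K2)
       \<or> K\<^bsub>card A,card B\<^esub> (with_proj G)"
proof -
  interpret bipartitioned_graph G A B using assms by (rule bipartitioned_graph.intro)
  have "card A > 0" "card B > 0" using parts finite_parts by (auto simp: card_gt_0_iff)
  then have "min (card A) (card B) = 1 \<longleftrightarrow> card A = 1 \<or> card B = 1" by linarith
  then show ?thesis
    unfolding domination_sum_iff_balanced complete_bipartite_iff
      balanced_iff[OF finite_parts parts(3,4)]
    using two_K2_iff by blast
qed

end
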